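(* The following graphs are double approval interval graphs: (1) the complete graphs $K_n$ for every positive integer $n$; (2) the cycles $C_n$ for every $n \geq 3$; (3) the wheels $W_n$ for every $n\ge3$; (4) the complete bipartite graphs $K_{m,n}$ for all positive integers $m,n$; (5) all (finite) trees.
   Context: All graphs are finite and simple. The wheel $W_n$ is the graph on $n+1$ vertices obtained from $C_n$ by adding a vertex adjacent to all cycle vertices. An approval interval is a triple $I(a)=(a_l,a_a,a_r)$ of reals with $a_l<a_a<a_r$: the closed interval $[a_l,a_r]$ with approval mark $a_a$. A double approval interval representation of a graph $G$ assigns to each vertex $a$ an approval interval $I(a)$ such that distinct vertices $a,b$ are adjacent if and only if $[a_l,a_r]$ and $[b_l,b_r]$ intersect and their intersection contains both approval marks $a_a$ and $b_a$. A graph is a double approval interval graph if it has such a representation. *)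

theory Defs
  imports Complex_Main "Graph_Theory.Graph_Theory"
begin

text \<open>
  Finite simple graphs are the \<^locale>\<open>graph\<close>s of the \<^emph>\<open>Graph_Theory\<close> library, i.e. finite
  symmetric digraphs without loops and parallel arcs. The graph classes below are predicates
  that are closed under isomorphism, in the style of \<^const>\<open>complete_digraph\<close> and
  \<^const>\<open>complete_bipartite_digraph\<close>.
\<close>

definition cycle_graph :: "nat \<Rightarrow> ('a, 'b) pre_digraph \<Rightarrow> bool" where
  "cycle_graph n G \<longleftrightarrow> graph G \<and>
     (\<exists>c. bij_betw c {..<n} (verts G) \<and>
          arcs_ends G = (\<Union>i<n. {(c i, c (Suc i mod n)), (c (Suc i mod n), c i)}))"

definition wheel_graph :: "nat \<Rightarrow> ('a, 'b) pre_digraph \<Rightarrow> bool" where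
  "wheel_graph n G \<longleftrightarrow> graph G \<and>
     (\<exists>(C :: 'a pair_pre_digraph) h. cycle_graph n (with_proj C) \<and> h \<notin> pverts C \<and>
          verts G = insert h (pverts C) \<and>
          arcs_ends G = parcs C \<union> {h} \<times> pverts C \<union> pverts C \<times> {h})"

text \<open>
  The library predicate \<^const>\<open>tree\<close> is not usable for undirected graphs: in a symmetric
  digraph every edge yields a \<^const>\<open>pre_digraph.cycle\<close> of length 2 (back and forth). The
  cycles of the undirected graph are those of length at least 3.
\<close>

definition tree_graph :: "('a, 'b) pre_digraph \<Rightarrow> bool" where
  "tree_graph G \<longleftrightarrow> graph G \<and> Digraph_Component.connected G \<and>
     \<not> (\<exists>p. pre_digraph.cycle G p \<and> 3 \<le> length p)"

record approval_interval =
  left_end :: real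
  mark :: real
  right_end :: real

definition approval_interval :: "approval_interval \<Rightarrow> bool" where
  "approval_interval I \<longleftrightarrow> left_end I < mark I \<and> mark I < right_end I"

definition span_of :: "approval_interval \<Rightarrow> real set" where
  "span_of I = {left_end I .. right_end I}"

definition double_approval_representation ::
  "('a, 'b) pre_digraph \<Rightarrow> ('a \<Rightarrow> approval_interval) \<Rightarrow> bool" where
  "double_approval_representation G I \<longleftrightarrow>
     (\<forall>a \<in> verts G. approval_interval (I a)) \<and>
     (\<forall>a \<in> verts G. \<forall>b \<in> verts G. a \<noteq> b \<longrightarrow>
        (a \<rightarrow>\<^bsub>G\<^esub> b \<longleftrightarrow>
           span_of (I a) \<inter> span_of (I b) \<noteq> {} \<and>
           mark (I a) \<in> span_of (I a) \<inter> span_of (I b) \<and>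
           mark (I b) \<in> span_of (I a) \<inter> span_of (I b)))"

definition double_approval_interval_graph :: "('a, 'b) pre_digraph \<Rightarrow> bool" where
  "double_approval_interval_graph G \<longleftrightarrow> graph G \<and> (\<exists>I. double_approval_representation G I)"

end

theory Submission
  imports Defs
begin

text \<open>
  A finite graph is a double approval interval graph as soon as its vertices can be ordered such
  that, for \<open>u < v < w < x\<close>, edges \<open>uw\<close> and \<open>vx\<close> force the edge \<open>vw\<close>: put the marks in this
  order and let the interval of each vertex reach just beyond its extreme neighbours. Complete
  graphs, cycles, wheels (hub between the first and the second cycle vertex) and complete bipartite
  graphs (one side before the other) have explicit orders of this kind. For a tree, one adds
  leaves one at a time, each immediately after its unique neighbour among the earlier vertices.
\<close>

section \<open>Vertex orders and the intervals built from them\<close>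

text \<open>The order is relative to a set \<open>S\<close> so that trees can be handled by growing
  \<open>S\<close>. Real values leave room to put a new vertex immediately after a given
  one.\<close>

definition approval_order :: "('a, 'b) pre_digraph \<Rightarrow> 'a set \<Rightarrow> ('a \<Rightarrow> real) \<Rightarrow> bool" where
  "approval_order G S f \<longleftrightarrow> inj_on f S \<and>
     (\<forall>u\<in>S. \<forall>v\<in>S. \<forall>w\<in>S. \<forall>x\<in>S. f u < f v \<longrightarrow> f v < f w \<longrightarrow> f w < f x \<longrightarrow>
        u \<rightarrow>\<^bsub>G\<^esub> w \<longrightarrow> v \<rightarrow>\<^bsub>G\<^esub> x \<longrightarrow> v \<rightarrow>\<^bsub>G\<^esub> w)"

lemma approval_orderI:
  assumes "inj_on f S"
    and "\<And>u v w x. \<lbrakk>u \<in> S; v \<in> S; w \<in> S; x \<in> S; f u < f v; f v < f w; f w < f x;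
           u \<rightarrow>\<^bsub>G\<^esub> w; v \<rightarrow>\<^bsub>G\<^esub> x\<rbrakk> \<Longrightarrow> v \<rightarrow>\<^bsub>G\<^esub> w"
  shows "approval_order G S f"
  using assms unfolding approval_order_def by blast

lemma approval_orderD:
  assumes "approval_order G S f" "u \<in> S" "v \<in> S" "w \<in> S" "x \<in> S"
    "f u < f v" "f v < f w" "f w < f x" "u \<rightarrow>\<^bsub>G\<^esub> w" "v \<rightarrow>\<^bsub>G\<^esub> x"
  shows "v \<rightarrow>\<^bsub>G\<^esub> w"
  using assms unfolding approval_order_def by blast

text \<open>Half the least positive difference works. The gap \<open>d\<close> serves both as the
  overhang of the intervals beyond extreme neighbours and as the offset of a newly added
  leaf.\<close>

lemma finite_real_separation:
  fixes A :: "real set"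
  assumes "finite A"
  obtains d where "d > 0" "\<And>x y. \<lbrakk>x \<in> A; y \<in> A; x < y\<rbrakk> \<Longrightarrow> x + d < y"
proof -
  \<comment> \<open>The element 1 makes \<open>Min D\<close> meaningful when \<open>A\<close> has
    fewer than two elements.\<close>
  define D where "D = insert 1 ((\<lambda>(x, y). y - x) ` {(x, y) \<in> A \<times> A. x < y})"
  have fin: "finite D"
    unfolding D_def using assms by (auto intro: finite_subset[of _ "A \<times> A"])
  have "\<forall>z\<in>D. z > 0" by (auto simp: D_def)
  then have pos: "Min D > 0" using fin by (subst Min_gr_iff) (auto simp: D_def)
  have "Min D \<le> y - x" if "x \<in> A" "y \<in> A" "x < y" for x y
    by (rule Min_le[OF fin]) (use that in \<open>force simp: D_def\<close>)
  then have "x + Min D / 2 < y" if "x \<in> A" "y \<in> A" "x < y" for x y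
    using that pos by (smt (verit) field_sum_of_halves)
  with pos show ?thesis by (intro that[of "Min D / 2"]) auto
qed

lemma double_approval_interval_graph_if_order:
  assumes "graph G" "approval_order G (verts G) f"
  shows "double_approval_interval_graph G"
proof -
  interpret graph G by fact
  obtain d where d: "d > 0"
    "\<And>x y. \<lbrakk>x \<in> f ` verts G; y \<in> f ` verts G; x < y\<rbrakk> \<Longrightarrow> x + d < y"
    using finite_real_separation[of "f ` verts G"] by auto
  \<comment> \<open>Positions of the closed neighbourhood: \<open>v\<close> itself keeps the set
    nonempty and makes its extremes enclose \<open>f v\<close>.\<close>
  define N where "N v = f ` insert v {w \<in> verts G. v \<rightarrow>\<^bsub>G\<^esub> w}" for v
  have finN: "finite (N v)" and neN: "N v \<noteq> {}" for v
    unfolding N_def by auto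
  have N_in: "Min (N v) \<in> f ` verts G" "Max (N v) \<in> f ` verts G" if "v \<in> verts G" for v
    using Min_in[OF finN neN, of v] Max_in[OF finN neN, of v] that by (auto simp: N_def)
  have N_le: "Min (N v) \<le> f v" "f v \<le> Max (N v)" for v
    using finN[of v] by (auto intro!: Min_le Max_ge simp: N_def)
  have N_nb: "Min (N v) \<le> f w" "f w \<le> Max (N v)" if "v \<rightarrow>\<^bsub>G\<^esub> w" for v w
    using finN[of v] that adj_in_verts[OF that] by (auto intro!: Min_le Max_ge simp: N_def)
  \<comment> \<open>The overhang \<open>d\<close> makes the mark strictly interior, yet it is too
    small to reach any further mark.\<close>
  define I where "I v = \<lparr>left_end = Min (N v) - d, mark = f v, right_end = Max (N v) + d\<rparr>" for v
  have mark_I: "mark (I v) = f v" for v by (simp add: I_def)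
  have span_I: "f w \<in> span_of (I v) \<longleftrightarrow> Min (N v) \<le> f w \<and> f w \<le> Max (N v)"
    if "v \<in> verts G" "w \<in> verts G" for v w
    using d(1) d(2)[of "f w" "Min (N v)"] d(2)[of "Max (N v)" "f w"] N_in[OF that(1)] that
    by (force simp: span_of_def I_def)
  \<comment> \<open>This is where the order condition enters: \<open>a\<close> has a neighbour
    \<open>x\<close> at or beyond \<open>b\<close>, and \<open>b\<close> has a neighbour
    \<open>u\<close> at or before \<open>a\<close>. If \<open>x\<close> is \<open>b\<close> or
    \<open>u\<close> is \<open>a\<close>, the edge is already there; otherwise the condition applies
    to \<open>u\<close>, \<open>a\<close>, \<open>b\<close>, \<open>x\<close>.\<close>
  have key: "a \<rightarrow>\<^bsub>G\<^esub> b"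
    if ab: "a \<in> verts G" "b \<in> verts G" "f a < f b" and le: "f b \<le> Max (N a)" "Min (N b) \<le> f a"
    for a b
  proof -
    obtain x where x: "x \<in> verts G" "a \<rightarrow>\<^bsub>G\<^esub> x" "f b \<le> f x"
      using Max_in[OF finN neN, of a] le(1) ab by (auto simp: N_def)
    obtain u where u: "u \<in> verts G" "b \<rightarrow>\<^bsub>G\<^esub> u" "f u \<le> f a"
      using Min_in[OF finN neN, of b] le(2) ab by (auto simp: N_def)
    have inj: "inj_on f (verts G)" using assms(2) by (simp add: approval_order_def)
    have ub: "u \<rightarrow>\<^bsub>G\<^esub> b" using u(2) by (rule arcs_ends_symmetric[OF sym_arcs])
    consider "f b = f x" | "f u = f a" | "f u < f a" "f b < f x"
      using u x by linarith
    then show ?thesis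
    proof cases
      case 1 then show ?thesis using x ab inj by (metis inj_onD)
    next
      case 2 then show ?thesis using u ub ab inj by (metis inj_onD)
    next
      case 3 then show ?thesis
        using approval_orderD[OF assms(2) u(1) ab(1,2) x(1)] ab(3) ub x(2) by auto
    qed
  qed
  have "approval_interval (I v)" for v
    using N_le[of v] d(1) by (simp add: approval_interval_def I_def)
  moreover have "a \<rightarrow>\<^bsub>G\<^esub> b \<longleftrightarrow> f b \<in> span_of (I a) \<and> f a \<in> span_of (I b)"
    if "a \<in> verts G" "b \<in> verts G" "a \<noteq> b" for a b
  proof
    assume "a \<rightarrow>\<^bsub>G\<^esub> b"
    moreover from this have "b \<rightarrow>\<^bsub>G\<^esub> a" by (rule arcs_ends_symmetric[OF sym_arcs])
    ultimately show "f b \<in> span_of (I a) \<and> f a \<in> span_of (I b)"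
      using span_I that N_nb by simp
  next
    assume R: "f b \<in> span_of (I a) \<and> f a \<in> span_of (I b)"
    have "f a \<noteq> f b"
      using assms(2) that by (auto simp: approval_order_def dest: inj_onD)
    then consider "f a < f b" | "f b < f a" by linarith
    then show "a \<rightarrow>\<^bsub>G\<^esub> b"
    proof cases
      case 1 then show ?thesis using R key span_I that by simp
    next
      case 2
      then have "b \<rightarrow>\<^bsub>G\<^esub> a" using R key span_I that by simp
      then show ?thesis by (rule arcs_ends_symmetric[OF sym_arcs])
    qed
  qed
  \<comment> \<open>Each vertex's own mark must lie in the intersection too; a common mark then also
    makes the intersection nonempty.\<close>
  moreover have "f v \<in> span_of (I v)" if "v \<in> verts G" for v
    using span_I[OF that that] N_le by simp
  ultimately have "double_approval_representation G I"
    unfolding double_approval_representation_def mark_I by blast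
  then show ?thesis
    using assms(1) by (auto simp: double_approval_interval_graph_def)
qed

section \<open>Explicit orders for complete, complete bipartite, cycle and wheel graphs\<close>

lemma complete_digraph_double_approval:
  assumes "complete_digraph n G"
  shows "double_approval_interval_graph G"
proof -
  have G: "graph G" and E: "arcs_ends G = {(u, v). (u, v) \<in> verts G \<times> verts G \<and> u \<noteq> v}"
    using assms by (auto simp: complete_digraph_def)
  interpret graph G by fact
  obtain f :: "'a \<Rightarrow> nat" where f: "inj_on f (verts G)"
    using finite_imp_inj_to_nat_seg[OF finite_verts] by blast
  have "approval_order G (verts G) (\<lambda>v. real (f v))"
    by (rule approval_orderI) (use f E in \<open>auto simp: inj_on_def\<close>)
  with G show ?thesis by (rule double_approval_interval_graph_if_order)
qed

text \<open>With \<open>U\<close> before \<open>V\<close>, every edge read from left to right goes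
  from \<open>U\<close> to \<open>V\<close>. So the edge \<open>uw\<close> puts \<open>w\<close> in
  \<open>V\<close>, the edge \<open>vx\<close> puts \<open>v\<close> in \<open>U\<close>, and
  \<open>v\<close> and \<open>w\<close> are adjacent.\<close>

lemma complete_bipartite_digraph_double_approval:
  assumes "complete_bipartite_digraph m n G"
  shows "double_approval_interval_graph G"
proof -
  obtain U V where G: "graph G" and UV: "verts G = U \<union> V" "U \<inter> V = {}"
    and E: "arcs_ends G = U \<times> V \<union> V \<times> U"
    using assms by (auto simp: complete_bipartite_digraph_def)
  interpret graph G by fact
  obtain g :: "'a \<Rightarrow> nat" and k where g: "inj_on g (verts G)" "g ` verts G = {i. i < k}"
    using finite_imp_inj_to_nat_seg[OF finite_verts] by metis
  \<comment> \<open>All values of \<open>g\<close> on vertices are below \<open>k\<close>, so the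
    shift moves \<open>V\<close> past \<open>U\<close>.\<close>
  define f where "f v = real (if v \<in> U then g v else g v + k)" for v
  have less: "g v < k" if "v \<in> verts G" for v using g(2) that by auto
  have inj: "inj_on f (verts G)"
  proof (rule inj_onI)
    fix x y assume "x \<in> verts G" "y \<in> verts G" "f x = f y"
    then show "x = y"
      using less[of x] less[of y] inj_onD[OF g(1)] by (auto simp: f_def split: if_splits)
  qed
  have UV_less: "v \<in> U" if "w \<in> U" "f v < f w" "v \<in> verts G" for v w
    using that less[of w] UV(1) by (auto simp: f_def split: if_splits)
  have "approval_order G (verts G) f"
  proof (rule approval_orderI[OF inj])
    fix u v w x
    assume *: "u \<in> verts G" "v \<in> verts G" "w \<in> verts G" "x \<in> verts G"
      "f u < f v" "f v < f w" "f w < f x" "u \<rightarrow>\<^bsub>G\<^esub> w" "v \<rightarrow>\<^bsub>G\<^esub> x"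
    have "w \<notin> U"
      using *(1,5,6,8) UV_less[of w u] E UV(2) by auto
    moreover have "v \<in> U"
      using * UV_less[of x v] E UV(2) by auto
    ultimately show "v \<rightarrow>\<^bsub>G\<^esub> w" using *(3) E UV(1) by auto
  qed
  with G show ?thesis by (rule double_approval_interval_graph_if_order)
qed

text \<open>\<open>Suc k mod n\<close> differs from \<open>Suc k\<close> only for
  \<open>Suc k = n\<close>, where it is 0; this is the one edge that can pass over other
  vertices.\<close>

lemma cycle_adjD:
  assumes "inj_on c {..<n}" "i < n" "j < n" "i < j"
    "(c i, c j) \<in> (\<Union>k<n. {(c k, c (Suc k mod n)), (c (Suc k mod n), c k)})"
  shows "j = Suc i \<or> (i = 0 \<and> Suc j = n)"
proof -
  obtain k where k: "k < n"
    "c i = c k \<and> c j = c (Suc k mod n) \<or> c j = c k \<and> c i = c (Suc k mod n)"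
    using assms(5) by auto
  moreover have "Suc k mod n < n" using k by simp
  ultimately have "i = k \<and> j = Suc k mod n \<or> j = k \<and> i = Suc k mod n"
    using inj_onD[OF assms(1)] assms(2,3) by (metis lessThan_iff)
  then show ?thesis
    using assms(4) k(1) by (cases "Suc k = n") auto
qed

text \<open>The condition holds vacuously along the cycle: the edge \<open>uw\<close> passes over
  \<open>v\<close>, so it is the wrap-around edge and \<open>w\<close> is last, leaving no place for
  \<open>x\<close>.\<close>

lemma cycle_graph_double_approval:
  assumes "cycle_graph n G"
  shows "double_approval_interval_graph G"
proof -
  obtain c where G: "graph G" and c: "bij_betw c {..<n} (verts G)"
    and E: "arcs_ends G = (\<Union>i<n. {(c i, c (Suc i mod n)), (c (Suc i mod n), c i)})"
    using assms by (auto simp: cycle_graph_def)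
  have inj: "inj_on c {..<n}" and im: "verts G = c ` {..<n}"
    using c by (auto simp: bij_betw_def)
  define f where "f v = real (inv_into {..<n} c v)" for v
  have f_c: "f (c i) = real i" if "i < n" for i
    using inv_into_f_f[OF inj] that by (simp add: f_def)
  have "approval_order G (verts G) f"
  proof (rule approval_orderI)
    show "inj_on f (verts G)" by (auto simp: im f_c inj_on_def)
    fix u v w x
    assume *: "u \<in> verts G" "v \<in> verts G" "w \<in> verts G" "x \<in> verts G"
      "f u < f v" "f v < f w" "f w < f x" "u \<rightarrow>\<^bsub>G\<^esub> w" "v \<rightarrow>\<^bsub>G\<^esub> x"
    then obtain i j k l where ijkl: "u = c i" "v = c j" "w = c k" "x = c l"
      "i < j" "j < k" "k < l" "l < n"
      by (auto simp: im f_c)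
    with cycle_adjD[OF inj, of i k] *(8) E have False by auto
    then show "v \<rightarrow>\<^bsub>G\<^esub> w" ..
  qed
  with G show ?thesis by (rule double_approval_interval_graph_if_order)
qed

text \<open>The hub at 1/2 lies between \<open>c 0\<close> and \<open>c 1\<close>. In the forbidden
  pattern \<open>v\<close> has a predecessor \<open>u\<close>, so \<open>v\<close> is not
  \<open>c 0\<close>; this forces \<open>v\<close> to be the hub, which is adjacent to
  \<open>w\<close>.\<close>

lemma wheel_graph_double_approval:
  assumes "wheel_graph n G"
  shows "double_approval_interval_graph G"
proof -
  obtain C :: "'a pair_pre_digraph" and h where G: "graph G" and C: "cycle_graph n (with_proj C)"
    and h: "h \<notin> pverts C" "verts G = insert h (pverts C)"
    and E: "arcs_ends G = parcs C \<union> {h} \<times> pverts C \<union> pverts C \<times> {h}"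
    using assms by (auto simp: wheel_graph_def)
  obtain c where c: "bij_betw c {..<n} (pverts C)"
    and EC: "parcs C = (\<Union>i<n. {(c i, c (Suc i mod n)), (c (Suc i mod n), c i)})"
    using C by (auto simp: cycle_graph_def)
  have inj: "inj_on c {..<n}" and im: "pverts C = c ` {..<n}"
    using c by (auto simp: bij_betw_def)
  define f where "f v = (if v = h then 1 / 2 else real (inv_into {..<n} c v))" for v
  have f_h: "f h = 1 / 2" by (simp add: f_def)
  have f_c: "f (c i) = real i" if "i < n" for i
    using inv_into_f_f[OF inj] that h(1) im by (auto simp: f_def)
  have half: "real i \<noteq> 1 / 2" for i
  proof
    assume "real i = 1 / 2"
    then have "real (2 * i) = real 1" by simp
    then show False by (simp only: of_nat_eq_iff) presburger
  qed
  have "approval_order G (verts G) f"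
  proof (rule approval_orderI)
    show "inj_on f (verts G)"
      using half by (auto simp: im h(2) f_c f_h inj_on_def)
    fix u v w x
    assume *: "u \<in> verts G" "v \<in> verts G" "w \<in> verts G" "x \<in> verts G"
      "f u < f v" "f v < f w" "f w < f x" "u \<rightarrow>\<^bsub>G\<^esub> w" "v \<rightarrow>\<^bsub>G\<^esub> x"
    \<comment> \<open>Among cycle vertices, an edge \<open>vx\<close> passing over \<open>w\<close>
      is the wrap-around edge, so \<open>v\<close> would be \<open>c 0\<close>.\<close>
    have vwx: "v = h \<or> w = h \<or> x = h"
    proof (rule ccontr)
      assume "\<not> ?thesis"
      then obtain j k l where jkl: "v = c j" "w = c k" "x = c l" "j < k" "k < l" "l < n"
        using *(2-4,6,7) by (auto simp: h(2) im f_c)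
      moreover from this have "(c j, c l) \<in> parcs C" using *(9) E h(1) im by auto
      ultimately have "j = 0" using cycle_adjD[OF inj, of j l] EC by auto
      have "0 \<le> f u" by (simp add: f_def)
      then show False using *(5) jkl \<open>j = 0\<close> f_c[of 0] by simp
    qed
    have "0 \<le> f u" by (simp add: f_def)
    \<comment> \<open>Here \<open>v\<close> precedes the hub, and the only cycle vertex below 1/2 is
      \<open>c 0\<close>, again too early for \<open>u\<close>.\<close>
    have False if "w = h \<or> x = h"
    proof -
      have uv: "f v < 1 / 2" "v \<noteq> h" using that *(5-7) f_h by auto
      then obtain j where "v = c j" "j < n" using *(2) by (auto simp: h(2) im)
      then show False using uv(1) *(5) \<open>0 \<le> f u\<close> f_c[of j] by (cases j) auto
    qed
    with vwx have "v = h" by blast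
    then show "v \<rightarrow>\<^bsub>G\<^esub> w" using * E h(2) by auto
  qed
  with G show ?thesis by (rule double_approval_interval_graph_if_order)
qed

section \<open>Trees, grown one leaf at a time\<close>

text \<open>Two distinct neighbours of \<open>t\<close> in \<open>S\<close> would be joined by a
  path inside \<open>S\<close>, which avoids \<open>t\<close>; closing it up through
  \<open>t\<close> gives a cycle.\<close>

lemma unique_neighbour_of_path_connected:
  assumes "graph G" and acyclic: "\<not> (\<exists>p. pre_digraph.cycle G p \<and> 3 \<le> length p)"
    and S: "\<And>u v. \<lbrakk>u \<in> S; v \<in> S\<rbrakk> \<Longrightarrow>
      \<exists>p. pre_digraph.apath G u p v \<and> set (pre_digraph.awalk_verts G u p) \<subseteq> S"
    and "s \<in> S" "s' \<in> S" "t \<notin> S" "s \<rightarrow>\<^bsub>G\<^esub> t" "s' \<rightarrow>\<^bsub>G\<^esub> t"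
  shows "s = s'"
proof (rule ccontr)
  assume ne: "s \<noteq> s'"
  interpret graph G by fact
  obtain p where p: "apath s p s'" "set (awalk_verts s p) \<subseteq> S"
    using S assms(4,5) by blast
  have "t \<rightarrow>\<^bsub>G\<^esub> s" using assms(7) by (rule arcs_ends_symmetric[OF sym_arcs])
  then obtain e where e: "e \<in> arcs G" "tail G e = t" "head G e = s"
    by (auto simp: arcs_ends_conv)
  obtain e' where e': "e' \<in> arcs G" "tail G e' = s'" "head G e' = t"
    using assms(8) by (auto simp: arcs_ends_conv)
  have p': "awalk s p s'" "distinct (awalk_verts s p)" using p(1) by (auto simp: apath_def)
  have "awalk s' [e'] t" using e' arc_implies_awalk by fastforce
  then have w: "awalk s (p @ [e']) t" using p'(1) by (rule awalk_appendI[rotated])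
  then have "awalk_verts s (p @ [e']) = awalk_verts s p @ [t]"
    using p'(1) e' by (subst awalk_verts_append) auto
  \<comment> \<open>The cycle is based at \<open>t\<close>: out along \<open>e\<close> to
    \<open>s\<close>, along \<open>p\<close> to \<open>s'\<close>, and back along
    \<open>e'\<close>.\<close>
  then have "cycle (e # p @ [e'])"
    unfolding cycle_def using w e p' p(2) assms(6) by (intro exI[of _ t]) (auto simp: awalk_Cons_iff)
  \<comment> \<open>Distinctness of \<open>s\<close> and \<open>s'\<close> is what excludes a mere
    back-and-forth of length 2.\<close>
  moreover have "p \<noteq> []" using p'(1) ne by (auto simp: awalk_Nil_iff)
  then have "3 \<le> length (e # p @ [e'])" by (cases p) auto
  ultimately show False using acyclic by blast
qed

text \<open>Placed right after \<open>s\<close>, its only neighbour in \<open>S\<close>, the vertex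
  \<open>t\<close> cannot occur in the forbidden pattern, since both edges there pass over a vertex.
  The old order settles the rest.\<close>

lemma approval_order_insert:
  assumes "graph G" "finite S" "approval_order G S f" "s \<in> S" "t \<notin> S"
    and unique: "\<And>v. \<lbrakk>v \<in> S; v \<rightarrow>\<^bsub>G\<^esub> t\<rbrakk> \<Longrightarrow> v = s"
  shows "\<exists>g. approval_order G (insert t S) g"
proof -
  interpret graph G by fact
  obtain d where d: "d > 0" "\<And>x y. \<lbrakk>x \<in> f ` S; y \<in> f ` S; x < y\<rbrakk> \<Longrightarrow> x + d < y"
    using finite_real_separation[of "f ` S"] assms(2) by auto
  \<comment> \<open>By the choice of \<open>d\<close>, no old value lies strictly between
    \<open>f s\<close> and \<open>f s + d\<close> or equals \<open>f s + d\<close>.\<close>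
  define g where "g = f(t := f s + d)"
  have g_S: "g v = f v" if "v \<in> S" for v using that assms(5) by (auto simp: g_def)
  have g_t: "g t = f s + d" by (simp add: g_def)
  have gap: "g v < f s + d \<longleftrightarrow> g v \<le> f s" "g v \<noteq> f s + d" if "v \<in> S" for v
    using d(1) d(2)[of "f s" "f v"] that assms(4) g_S[OF that] by (force, force)
  have unique': "v = s" if "t \<rightarrow>\<^bsub>G\<^esub> v" "v \<in> S" for v
    using unique that arcs_ends_symmetric[OF sym_arcs that(1)] by blast
  have no_loop: "\<not> t \<rightarrow>\<^bsub>G\<^esub> t" using adj_not_same by blast
  have inj: "inj_on f S" using assms(3) by (simp add: approval_order_def)
  have "approval_order G (insert t S) g"
  proof (rule approval_orderI)
    show "inj_on g (insert t S)"
      using inj gap g_S g_t by (auto simp: inj_on_def) metis+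
    fix u v w x
    assume *: "u \<in> insert t S" "v \<in> insert t S" "w \<in> insert t S" "x \<in> insert t S"
      "g u < g v" "g v < g w" "g w < g x" "u \<rightarrow>\<^bsub>G\<^esub> w" "v \<rightarrow>\<^bsub>G\<^esub> x"
    \<comment> \<open>An edge at \<open>t\<close> joins it to \<open>s\<close>, its immediate
      predecessor, so no \<open>y\<close> fits between the ends.\<close>
    have short: False if "a \<in> insert t S" "b \<in> insert t S" "a \<rightarrow>\<^bsub>G\<^esub> b" "t = a \<or> t = b"
      "y \<in> insert t S" "g a < g y" "g y < g b" for a b y
    proof -
      have "a = s \<and> b = t \<or> a = t \<and> b = s"
        using that unique unique' no_loop by auto
      then show False
        using that(5-7) d(1) gap[of y] g_t g_S[OF assms(4)] by auto
    qed
    have "t \<notin> {u, v, w, x}"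
      using short[of u w v] short[of v x w] * by auto
    then show "v \<rightarrow>\<^bsub>G\<^esub> w"
      using approval_orderD[OF assms(3), of u v w x] * by (auto simp: g_S)
  qed
  then show ?thesis by blast
qed

text \<open>A maximal internally path-connected vertex set that contains a root and admits an
  approval order is closed under adjacency, since otherwise a further leaf could be added. By
  connectedness it contains every vertex.\<close>

lemma tree_graph_double_approval:
  assumes "tree_graph G"
  shows "double_approval_interval_graph G"
proof -
  have G: "graph G" and conn: "Digraph_Component.connected G"
    and acyclic: "\<not> (\<exists>p. pre_digraph.cycle G p \<and> 3 \<le> length p)"
    using assms by (auto simp: tree_graph_def)
  interpret graph G by fact
  \<comment> \<open>Connectedness refers to the symmetric closure, which has the same reachability
    as the already symmetric \<open>G\<close>.\<close>
  have reach: "u \<rightarrow>\<^sup>*\<^bsub>G\<^esub> v" if "u \<in> verts G" "v \<in> verts G" for u v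
    using conn that reachable_mk_symmetric_eq[OF sym_arcs]
    by (auto simp: connected_def strongly_connected_def)
  obtain r where r: "r \<in> verts G"
    using conn by (auto simp: connected_def strongly_connected_def)
  \<comment> \<open>Paths must stay inside \<open>S\<close>: this is what makes them avoid an
    outside vertex \<open>t\<close> in the uniqueness argument.\<close>
  define good where "good S \<longleftrightarrow> r \<in> S \<and> S \<subseteq> verts G \<and>
    (\<forall>u\<in>S. \<forall>v\<in>S. \<exists>p. apath u p v \<and> set (awalk_verts u p) \<subseteq> S) \<and>
    (\<exists>f. approval_order G S f)" for S
  have "good {r}"
    unfolding good_def using r
    by (auto simp: approval_order_def apath_Nil_iff intro!: exI[of _ "[]"])
  moreover have "finite {S. good S}"
    by (rule finite_subset[of _ "Pow (verts G)"]) (auto simp: good_def)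
  ultimately obtain S where S: "good S" and max: "\<And>T. good T \<Longrightarrow> S \<subseteq> T \<Longrightarrow> T = S"
    using finite_has_maximal[of "{S. good S}"] by blast
  from S have Sr: "r \<in> S" and SV: "S \<subseteq> verts G" and
    paths: "\<And>u v. \<lbrakk>u \<in> S; v \<in> S\<rbrakk> \<Longrightarrow> \<exists>p. apath u p v \<and> set (awalk_verts u p) \<subseteq> S"
    by (auto simp: good_def)
  obtain f where f: "approval_order G S f" using S by (auto simp: good_def)
  have closed: "t \<in> S" if s: "s \<in> S" and st: "s \<rightarrow>\<^bsub>G\<^esub> t" for s t
  proof (rule ccontr)
    assume t: "t \<notin> S"
    have tV: "t \<in> verts G" using adj_in_verts[OF st] by simp
    have "v = s" if "v \<in> S" "v \<rightarrow>\<^bsub>G\<^esub> t" for v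
      using unique_neighbour_of_path_connected[OF G acyclic paths that(1) s t that(2) st] .
    then have "\<exists>g. approval_order G (insert t S) g"
      using approval_order_insert[OF G _ f s t] finite_subset[OF SV finite_verts] by blast
    \<comment> \<open>Paths that start or end at \<open>t\<close> are old paths extended by an arc
      between \<open>s\<close> and \<open>t\<close>.\<close>
    moreover have "\<exists>p. apath u p v \<and> set (awalk_verts u p) \<subseteq> insert t S"
      if uv: "u \<in> insert t S" "v \<in> insert t S" for u v
    proof -
      obtain e where e: "e \<in> arcs G" "tail G e = s" "head G e = t"
        using st by (auto simp: arcs_ends_conv)
      obtain e' where e': "e' \<in> arcs G" "tail G e' = t" "head G e' = s"
        using arcs_ends_symmetric[OF sym_arcs st] by (auto simp: arcs_ends_conv)
      consider "u \<in> S" "v \<in> S" | "u = t" "v = t" | "u = t" "v \<in> S" | "u \<in> S" "v = t"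
        using uv by blast
      then show ?thesis
      proof cases
        case 1 then show ?thesis using paths by blast
      next
        case 2 then show ?thesis using tV by (intro exI[of _ "[]"]) (auto simp: apath_Nil_iff)
      next
        case 3
        then obtain p where "apath s p v" "set (awalk_verts s p) \<subseteq> S" using paths s by blast
        then show ?thesis
          using 3 e' t by (intro exI[of _ "e' # p"]) (auto simp: apath_Cons_iff)
      next
        case 4
        then obtain p where p: "apath u p s" "set (awalk_verts u p) \<subseteq> S" using paths s by blast
        then have last: "awlast u p = s" by (auto simp: apath_def)
        have w: "apath s [e] t"
          using e tV t s by (auto simp: apath_simps)
        have "apath u (p @ [e]) t"
          using p last w t e by (auto simp: apath_append_iff)
        moreover from this have "awalk_verts u (p @ [e]) = awalk_verts u p @ [t]"
          using last e by (subst awalk_verts_append) (auto simp: apath_def)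
        ultimately show ?thesis using 4 p(2) by (intro exI[of _ "p @ [e]"]) auto
      qed
    qed
    ultimately have "good (insert t S)"
      using Sr SV tV unfolding good_def by blast
    with max[of "insert t S"] t show False by blast
  qed
  have "v \<in> S" if "r \<rightarrow>\<^sup>*\<^bsub>G\<^esub> v" for v
    using that by (induction rule: reachable_induct) (auto intro: Sr closed)
  then have "S = verts G" using SV reach[OF r] by blast
  with G f show ?thesis by (auto intro: double_approval_interval_graph_if_order)
qed

theorem theorem25:
  shows "(\<forall>n \<ge> 1. \<forall>G :: ('a, 'b) pre_digraph.
            complete_digraph n G \<longrightarrow> double_approval_interval_graph G) \<and>
         (\<forall>n \<ge> 3. \<forall>G :: ('a, 'b) pre_digraph.
            cycle_graph n G \<longrightarrow> double_approval_interval_graph G) \<and>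
         (\<forall>n \<ge> 3. \<forall>G :: ('a, 'b) pre_digraph.
            wheel_graph n G \<longrightarrow> double_approval_interval_graph G) \<and>
         (\<forall>m \<ge> 1. \<forall>n \<ge> 1. \<forall>G :: ('a, 'b) pre_digraph.
            complete_bipartite_digraph m n G \<longrightarrow> double_approval_interval_graph G) \<and>
         (\<forall>G :: ('a, 'b) pre_digraph.
            tree_graph G \<longrightarrow> double_approval_interval_graph G)"
  using complete_digraph_double_approval cycle_graph_double_approval wheel_graph_double_approval
    complete_bipartite_digraph_double_approval tree_graph_double_approval
  by blast

end
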